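(* Let $\Omega$ be the finite voxel grid of scene $j$, with ground-truth labels $y_j:\Omega\to\{1,\dots,K\}$, teacher predictions $t_j:\Omega\to\{1,\dots,K\}$, and refiner predictions $g_j:\Omega\to\{1,\dots,K\}$. Let $M_j:\Omega\to\{0,1\}$ be an error-candidate mask, dividing the grid into the unreliable region $E_j=\{\omega\in\Omega: M_j(\omega)=1\}$, assumed nonempty, and the reliable region $C_j=\Omega\setminus E_j$. Let $\pi_j$ be the precision of the mask, i.e. the fraction of voxels in $E_j$ misclassified by the teacher. Let $q_j$ be the rate at which the refiner corrects the teacher's misclassifications in $E_j$, and let $r_j$ be the rate at which the refiner incorrectly changes the teacher's correct predictions in $E_j$. If $q_j+r_j>0$, then the refinement improves the accuracy for scene $j$, i.e. the accuracy of the refined labels $\tilde y_j$ (equal to $g_j$ on $E_j$ and to $t_j$ on $C_j$) is strictly greater than the accuracy of the teacher predictions $t_j$, if and only if $$\zeta_j := \pi_j - \frac{r_j}{q_j+r_j} > 0.$$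
   Context: $K$ is the number of classes. The accuracy of a labeling $\ell:\Omega\to\{1,\dots,K\}$ is $|\{\omega\in\Omega:\ell(\omega)=y_j(\omega)\}|/|\Omega|$. The refined labeling is $\tilde y_j(\omega)=g_j(\omega)$ if $\omega\in E_j$ and $\tilde y_j(\omega)=t_j(\omega)$ if $\omega\in C_j$; that is, the refiner acts only on $E_j$, and the teacher's prediction is kept on $C_j$. Write $W_j=\{\omega\in E_j: t_j(\omega)\neq y_j(\omega)\}$ (teacher misclassifications in $E_j$) and $R_j=\{\omega\in E_j: t_j(\omega)=y_j(\omega)\}$ (correct teacher predictions in $E_j$). Then $$\pi_j=\frac{|W_j|}{|E_j|},\qquad q_j=\frac{|\{\omega\in W_j: g_j(\omega)=y_j(\omega)\}|}{|W_j|},\qquad r_j=\frac{|\{\omega\in R_j: g_j(\omega)\neq y_j(\omega)\}|}{|R_j|},$$ where a rate over an empty set ($W_j=\emptyset$ or $R_j=\emptyset$) is taken to be $0$. *)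

theory Defs
  imports Complex_Main "HOL-Library.FuncSet"
begin

definition accuracy :: "'v set \<Rightarrow> ('v \<Rightarrow> nat) \<Rightarrow> ('v \<Rightarrow> nat) \<Rightarrow> real" where
  "accuracy \<Omega> y l = real (card {\<omega> \<in> \<Omega>. l \<omega> = y \<omega>}) / real (card \<Omega>)"

definition unreliable_region :: "'v set \<Rightarrow> ('v \<Rightarrow> nat) \<Rightarrow> 'v set" where
  "unreliable_region \<Omega> M = {\<omega> \<in> \<Omega>. M \<omega> = 1}"

(* On the grid, the complement of E is the reliable region. *)
definition refined :: "'v set \<Rightarrow> ('v \<Rightarrow> nat) \<Rightarrow> ('v \<Rightarrow> nat) \<Rightarrow> 'v \<Rightarrow> nat" where
  "refined E t g = (\<lambda>\<omega>. if \<omega> \<in> E then g \<omega> else t \<omega>)"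

definition teacher_wrong :: "'v set \<Rightarrow> ('v \<Rightarrow> nat) \<Rightarrow> ('v \<Rightarrow> nat) \<Rightarrow> 'v set" where
  "teacher_wrong E y t = {\<omega> \<in> E. t \<omega> \<noteq> y \<omega>}"

definition teacher_right :: "'v set \<Rightarrow> ('v \<Rightarrow> nat) \<Rightarrow> ('v \<Rightarrow> nat) \<Rightarrow> 'v set" where
  "teacher_right E y t = {\<omega> \<in> E. t \<omega> = y \<omega>}"

definition mask_precision :: "'v set \<Rightarrow> ('v \<Rightarrow> nat) \<Rightarrow> ('v \<Rightarrow> nat) \<Rightarrow> real" where
  "mask_precision E y t = real (card (teacher_wrong E y t)) / real (card E)"

(* Since x / 0 = 0, the next two rates are 0 when their reference set is empty, as intended. *)
definition correction_rate ::
    "'v set \<Rightarrow> ('v \<Rightarrow> nat) \<Rightarrow> ('v \<Rightarrow> nat) \<Rightarrow> ('v \<Rightarrow> nat) \<Rightarrow> real" where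
  "correction_rate E y t g =
     real (card {\<omega> \<in> teacher_wrong E y t. g \<omega> = y \<omega>}) / real (card (teacher_wrong E y t))"

definition corruption_rate ::
    "'v set \<Rightarrow> ('v \<Rightarrow> nat) \<Rightarrow> ('v \<Rightarrow> nat) \<Rightarrow> ('v \<Rightarrow> nat) \<Rightarrow> real" where
  "corruption_rate E y t g =
     real (card {\<omega> \<in> teacher_right E y t. g \<omega> \<noteq> y \<omega>}) / real (card (teacher_right E y t))"

definition zeta ::
    "'v set \<Rightarrow> ('v \<Rightarrow> nat) \<Rightarrow> ('v \<Rightarrow> nat) \<Rightarrow> ('v \<Rightarrow> nat) \<Rightarrow> real" where
  "zeta E y t g = mask_precision E y t
     - corruption_rate E y t g / (correction_rate E y t g + corruption_rate E y t g)"

end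

theory Submission
  imports Defs
begin

text \<open>Refinement changes correctness only inside \<open>E\<close>: it gains the voxels of
  \<open>teacher_wrong\<close> that \<open>g\<close> repairs and loses those of
  \<open>teacher_right\<close> that \<open>g\<close> spoils. Let w and s be the sizes of these two
  sets and q and r the correction and corruption rates. Then the accuracy grows by (q*w - r*s) /
  \<open>card \<Omega>\<close> (\<open>accuracy_refined_diff\<close>, resting on the count
  \<open>card_refined_correct\<close>). Since the mask precision is w / (w + s), clearing
  denominators in r / (q + r) < w / (w + s) leaves r*s < q*w (\<open>zeta_pos_iff\<close>), which is
  the same sign condition.\<close>

text \<open>Undoes the division in the rate. If \<open>teacher_wrong\<close> is empty, the counted
  subset is empty too, so both sides are 0.\<close>

lemma correction_count:
  assumes "finite E"
  shows "real (card {\<omega> \<in> teacher_wrong E y t. g \<omega> = y \<omega>})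
    = correction_rate E y t g * real (card (teacher_wrong E y t))"
  using assms by (auto simp: correction_rate_def teacher_wrong_def)

lemma corruption_count:
  assumes "finite E"
  shows "real (card {\<omega> \<in> teacher_right E y t. g \<omega> \<noteq> y \<omega>})
    = corruption_rate E y t g * real (card (teacher_right E y t))"
  using assms by (auto simp: corruption_rate_def teacher_right_def)

lemma card_teacher_wrong_right:
  assumes "finite E"
  shows "card (teacher_wrong E y t) + card (teacher_right E y t) = card E"
proof -
  have "teacher_wrong E y t \<union> teacher_right E y t = E"
    by (auto simp: teacher_wrong_def teacher_right_def)
  moreover have "teacher_wrong E y t \<inter> teacher_right E y t = {}"
    by (auto simp: teacher_wrong_def teacher_right_def)
  moreover have "finite (teacher_wrong E y t)" "finite (teacher_right E y t)"
    using assms by (auto simp: teacher_wrong_def teacher_right_def)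
  ultimately show ?thesis
    by (simp add: card_Un_disjoint [symmetric])
qed

text \<open>Both sides count, as a disjoint union, the voxels at which the teacher or the refined
  labeling is correct. Sums on both sides avoid truncated subtraction on \<open>nat\<close>.\<close>

lemma card_refined_correct:
  assumes "finite \<Omega>" and "E \<subseteq> \<Omega>"
  shows "card {\<omega> \<in> \<Omega>. refined E t g \<omega> = y \<omega>} + card {\<omega> \<in> teacher_right E y t. g \<omega> \<noteq> y \<omega>}
    = card {\<omega> \<in> \<Omega>. t \<omega> = y \<omega>} + card {\<omega> \<in> teacher_wrong E y t. g \<omega> = y \<omega>}"
    (is "card ?G + card ?B = card ?T + card ?A")
proof -
  have fin: "finite E" "finite ?G" "finite ?T"
    using assms finite_subset by auto
  have "finite ?A" "finite ?B"
    using fin by (auto simp: teacher_wrong_def teacher_right_def)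
  moreover have "?G \<inter> ?B = {}" "?T \<inter> ?A = {}"
    by (auto simp: refined_def teacher_wrong_def teacher_right_def)
  moreover have "?G \<union> ?B = ?T \<union> ?A"
    using assms(2) by (auto simp: refined_def teacher_wrong_def teacher_right_def split: if_splits)
  ultimately show ?thesis
    using fin by (simp add: card_Un_disjoint [symmetric])
qed

lemma accuracy_refined_diff:
  assumes "finite \<Omega>" and "E \<subseteq> \<Omega>"
  shows "accuracy \<Omega> y (refined E t g) - accuracy \<Omega> y t
    = (correction_rate E y t g * real (card (teacher_wrong E y t))
        - corruption_rate E y t g * real (card (teacher_right E y t))) / real (card \<Omega>)"
proof -
  have "finite E"
    using assms finite_subset by auto
  \<comment> \<open>Casting the count to \<open>real\<close> allows genuine differences.\<close>
  with arg_cong[OF card_refined_correct[OF assms, of t g y], of real] show ?thesis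
    unfolding accuracy_def diff_divide_distrib [symmetric]
    by (simp add: correction_count corruption_count)
qed

lemma zeta_pos_iff:
  assumes "finite E" and "E \<noteq> {}"
    and "correction_rate E y t g + corruption_rate E y t g > 0"
  shows "zeta E y t g > 0 \<longleftrightarrow>
    corruption_rate E y t g * real (card (teacher_right E y t))
      < correction_rate E y t g * real (card (teacher_wrong E y t))"
proof -
  let ?q = "correction_rate E y t g" and ?r = "corruption_rate E y t g"
  let ?w = "real (card (teacher_wrong E y t))" and ?s = "real (card (teacher_right E y t))"
  have E: "real (card E) = ?w + ?s"
    using card_teacher_wrong_right[OF assms(1), of y t] by linarith
  have pos: "?w + ?s > 0"
    using assms(1,2) by (simp add: E [symmetric] card_gt_0_iff)
  have "zeta E y t g > 0 \<longleftrightarrow> ?r / (?q + ?r) < ?w / (?w + ?s)"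
    by (simp add: zeta_def mask_precision_def E)
  also have "\<dots> \<longleftrightarrow> ?r * (?w + ?s) < ?w * (?q + ?r)"
    by (subst pos_less_divide_eq[OF pos], subst times_divide_eq_left, subst pos_divide_less_eq[OF assms(3)]) (rule refl)
  \<comment> \<open>Both products contain \<open>?r * ?w\<close>, which cancels.\<close>
  also have "\<dots> \<longleftrightarrow> ?r * ?s < ?q * ?w"
    by (simp add: algebra_simps)
  finally show ?thesis .
qed

theorem proposition2:
  fixes \<Omega> E :: "'v set" and K :: nat and y t g M :: "'v \<Rightarrow> nat"
  assumes "finite \<Omega>"
    and "y \<in> \<Omega> \<rightarrow> {1..K}" and "t \<in> \<Omega> \<rightarrow> {1..K}" and "g \<in> \<Omega> \<rightarrow> {1..K}"
    and "M \<in> \<Omega> \<rightarrow> {0, 1}"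
    and "E = unreliable_region \<Omega> M" and "E \<noteq> {}"
    and "correction_rate E y t g + corruption_rate E y t g > 0"
  shows "accuracy \<Omega> y (refined E t g) > accuracy \<Omega> y t \<longleftrightarrow> zeta E y t g > 0"
proof -
  have sub: "E \<subseteq> \<Omega>"
    using assms(6) by (auto simp: unreliable_region_def)
  then have finE: "finite E" and "real (card \<Omega>) > 0"
    using assms(1,7) finite_subset by (auto simp: card_gt_0_iff)
  have "accuracy \<Omega> y (refined E t g) > accuracy \<Omega> y t \<longleftrightarrow>
      accuracy \<Omega> y (refined E t g) - accuracy \<Omega> y t > 0"
    by simp
  \<comment> \<open>A nonempty \<open>E\<close> makes \<open>\<Omega>\<close> nonempty, so dividing
    by \<open>card \<Omega>\<close> keeps the sign.\<close>
  also have "\<dots> \<longleftrightarrow> zeta E y t g > 0"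
    unfolding accuracy_refined_diff[OF assms(1) sub] zeta_pos_iff[OF finE assms(7,8)]
    using \<open>real (card \<Omega>) > 0\<close> by (simp add: zero_less_divide_iff)
  finally show ?thesis .
qed

end
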